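(* Let $(\Omega,\Sigma)$ be a standard Borel space, let $P\in NA^+$, let $R(P)=[0,P(\Omega)]$ be the range of $P$, and let $f:R(P)\to\mathbb{R}$ be a function with $f(0)=0$. Consider the game $\nu=f\circ P$. Then: (i) $\nu\ll_1 P$; (ii) $\nu\ll_2 P$ if and only if $f$ is continuous at $0$, if and only if there exists $\mu\in NA^+$ such that $\nu\ll_2\mu$; (iii) $\nu\ll_3 P$ if and only if $f$ is continuous, if and only if there exists $\mu\in NA^+$ such that $\nu\ll_3\mu$; (iv) $\nu\ll_4 P$ if and only if $f$ is absolutely continuous, if and only if there exists $\mu\in NA^+$ such that $\nu\ll_4\mu$; (v) $\nu$ is monotone if and only if $f$ is nondecreasing; (vi) $\nu\in BV$ if and only if $f$ is of bounded variation.
   Context: A game is a set function $\nu:\Sigma\to\mathbb{R}$ with $\nu(\emptyset)=0$; it is monotone if $\nu(A)\le\nu(B)$ whenever $A\subseteq B$ in $\Sigma$. $NA^+$ is the set of nonnegative (finite) nonatomic countably additive measures on $\Sigma$. A chain is a finite sequence $\emptyset=S_0\subset S_1\subset\dots\subset S_m=\Omega$ in $\Sigma$; a link is a pair $(S_{i-1},S_i)$ of consecutive elements; a subchain $\Lambda$ of a chain is a set of links of it, and $\|\nu\|_\Lambda=\sum|\nu(S_i)-\nu(S_{i-1})|$, the sum being over the links in $\Lambda$. $BV$ is the space of games of bounded variation, i.e. games with $\|\nu\|=\sup_C\|\nu\|_C<\infty$, the supremum being over all chains $C$. For $\mu\in NA^+$ and a game $\nu$: - $\nu\ll_1\mu$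 means $\mathcal N(\mu)\subset\mathcal N(\nu)$, where for a game $\eta$, $\mathcal N(\eta)=\{N\in\Sigma:\eta(N\cup A)=\eta(A)\text{ for every }A\in\Sigma\}$; - $\nu\ll_2\mu$ means: for every $\varepsilon>0$ there is $\delta>0$ such that $|\mu(E)|<\delta$ implies $|\nu(E)|<\varepsilon$, for $E\in\Sigma$; - $\nu\ll_3\mu$ means: for every $\varepsilon>0$ there is $\delta>0$ such that $\mu(A\Delta B)<\delta$ implies $|\nu(A)-\nu(B)|<\varepsilon$, for $A,B\in\Sigma$; - $\nu\ll_4\mu$ means: for every $\varepsilon>0$ there is $\delta>0$ such that for every chain and every subchain $\Lambda$ of it, $\|\mu\|_\Lambda<\delta$ implies $\|\nu\|_\Lambda<\varepsilon$. *)

theory Defs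
  imports "HOL-Analysis.Analysis"
begin

(* A measurable space (\<Omega>, \<Sigma>) is given by (space M, sets M); the values emeasure M are never used. *)
definition standard_borel_space :: "'a measure \<Rightarrow> bool" where
  "standard_borel_space M \<longleftrightarrow>
     (\<exists>X. completely_metrizable_space X \<and> separable_space X \<and> topspace X = space M \<and>
          sets M = sigma_sets (topspace X) {U. openin X U})"

(* A game is a total function on 'a set, of which only the values on sets M matter. *)
definition game :: "('a set \<Rightarrow> real) \<Rightarrow> bool" where
  "game \<nu> \<longleftrightarrow> \<nu> {} = 0"

definition nonatomic :: "'a measure \<Rightarrow> bool" where
  "nonatomic \<mu> \<longleftrightarrow>
     (\<forall>A\<in>sets \<mu>. emeasure \<mu> A > 0 \<longrightarrow>
        (\<exists>B\<in>sets \<mu>. B \<subseteq> A \<and> 0 < emeasure \<mu> B \<and> emeasure \<mu> B < emeasure \<mu> A))"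

definition NA_plus :: "'a measure \<Rightarrow> 'a measure set" where
  "NA_plus M = {\<mu>. sets \<mu> = sets M \<and> finite_measure \<mu> \<and> nonatomic \<mu>}"

(* The chain S 0, ..., S m; its inclusions need not be strict. A link (A, A) contributes 0
   to every variation sum, so nothing below depends on this choice. *)
definition is_chain :: "'a measure \<Rightarrow> (nat \<Rightarrow> 'a set) \<Rightarrow> nat \<Rightarrow> bool" where
  "is_chain M S m \<longleftrightarrow>
     S 0 = {} \<and> S m = space M \<and> (\<forall>i\<le>m. S i \<in> sets M) \<and> (\<forall>i<m. S i \<subseteq> S (Suc i))"

definition links :: "(nat \<Rightarrow> 'a set) \<Rightarrow> nat \<Rightarrow> ('a set \<times> 'a set) set" where
  "links S m = {(S i, S (Suc i)) | i. i < m}"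

definition subchain_norm :: "('a set \<Rightarrow> real) \<Rightarrow> ('a set \<times> 'a set) set \<Rightarrow> real" where
  "subchain_norm \<nu> \<Lambda> = (\<Sum>(A, B)\<in>\<Lambda>. \<bar>\<nu> B - \<nu> A\<bar>)"

definition variation_norm :: "'a measure \<Rightarrow> ('a set \<Rightarrow> real) \<Rightarrow> ennreal" where
  "variation_norm M \<nu> =
     (SUP (S, m) \<in> {(S, m). is_chain M S m}. ennreal (subchain_norm \<nu> (links S m)))"

definition BV :: "'a measure \<Rightarrow> ('a set \<Rightarrow> real) set" where
  "BV M = {\<nu>. game \<nu> \<and> variation_norm M \<nu> < \<infinity>}"

definition null_coalitions :: "'a measure \<Rightarrow> ('a set \<Rightarrow> real) \<Rightarrow> 'a set set" where
  "null_coalitions M \<eta> = {N \<in> sets M. \<forall>A\<in>sets M. \<eta> (N \<union> A) = \<eta> A}"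

definition ac1 :: "'a measure \<Rightarrow> ('a set \<Rightarrow> real) \<Rightarrow> 'a measure \<Rightarrow> bool" where
  "ac1 M \<nu> \<mu> \<longleftrightarrow> null_coalitions M (measure \<mu>) \<subseteq> null_coalitions M \<nu>"

definition ac2 :: "'a measure \<Rightarrow> ('a set \<Rightarrow> real) \<Rightarrow> 'a measure \<Rightarrow> bool" where
  "ac2 M \<nu> \<mu> \<longleftrightarrow>
     (\<forall>\<epsilon>>0. \<exists>\<delta>>0. \<forall>E\<in>sets M. \<bar>measure \<mu> E\<bar> < \<delta> \<longrightarrow> \<bar>\<nu> E\<bar> < \<epsilon>)"

definition ac3 :: "'a measure \<Rightarrow> ('a set \<Rightarrow> real) \<Rightarrow> 'a measure \<Rightarrow> bool" where
  "ac3 M \<nu> \<mu> \<longleftrightarrow>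
     (\<forall>\<epsilon>>0. \<exists>\<delta>>0. \<forall>A\<in>sets M. \<forall>B\<in>sets M.
        measure \<mu> (sym_diff A B) < \<delta> \<longrightarrow> \<bar>\<nu> A - \<nu> B\<bar> < \<epsilon>)"

definition ac4 :: "'a measure \<Rightarrow> ('a set \<Rightarrow> real) \<Rightarrow> 'a measure \<Rightarrow> bool" where
  "ac4 M \<nu> \<mu> \<longleftrightarrow>
     (\<forall>\<epsilon>>0. \<exists>\<delta>>0. \<forall>S m \<Lambda>. is_chain M S m \<longrightarrow> \<Lambda> \<subseteq> links S m \<longrightarrow>
        subchain_norm (measure \<mu>) \<Lambda> < \<delta> \<longrightarrow> subchain_norm \<nu> \<Lambda> < \<epsilon>)"

(* Absolute continuity and bounded variation of a real function on [a, b] in the classical sense. *)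
definition absolutely_continuous_fun :: "real \<Rightarrow> real \<Rightarrow> (real \<Rightarrow> real) \<Rightarrow> bool" where
  "absolutely_continuous_fun a b f \<longleftrightarrow>
     (\<forall>\<epsilon>>0. \<exists>\<delta>>0. \<forall>(n::nat) u v.
        (\<forall>i<n. a \<le> u i \<and> u i \<le> v i \<and> v i \<le> b) \<longrightarrow>
        disjoint_family_on (\<lambda>i. {u i<..<v i}) {..<n} \<longrightarrow>
        (\<Sum>i<n. v i - u i) < \<delta> \<longrightarrow> (\<Sum>i<n. \<bar>f (v i) - f (u i)\<bar>) < \<epsilon>)"

definition total_variation :: "real \<Rightarrow> real \<Rightarrow> (real \<Rightarrow> real) \<Rightarrow> ennreal" where
  "total_variation a b f =
     (SUP (x, n) \<in> {(x, n :: nat). x 0 = a \<and> x n = b \<and> (\<forall>i<n. x i \<le> x (Suc i))}.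
        ennreal (\<Sum>i<n. \<bar>f (x (Suc i)) - f (x i)\<bar>))"

definition bounded_variation_fun :: "real \<Rightarrow> real \<Rightarrow> (real \<Rightarrow> real) \<Rightarrow> bool" where
  "bounded_variation_fun a b f \<longleftrightarrow> total_variation a b f < \<infinity>"

end

theory Submission
  imports Defs
begin

text \<open>
  By Sierpinski's theorem a finite nonatomic measure \<open>P\<close> takes all intermediate values below any given
  measurable set, so every increasing finite sequence in \<open>[0, P(\<Omega>)]\<close> is realised by \<open>P\<close> along an
  increasing sequence of sets. This transports continuity, monotonicity and variation between \<open>f\<close>
  and \<open>f \<circ> P\<close>. To replace an arbitrary \<open>\<mu>\<close> by \<open>P\<close>, remove a \<open>P\<close>-null set \<open>N\<close> of maximal
  \<open>\<mu>\<close>-measure: off \<open>N\<close> the measure \<open>\<mu>\<close> is absolutely continuous with respect to \<open>P\<close>, while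
  \<open>f \<circ> P\<close> does not distinguish \<open>A\<close> from \<open>A - N\<close>.
\<close>

section \<open>Intermediate values and chains for finite nonatomic measures\<close>

lemma increasing_upto:
  fixes x :: "nat \<Rightarrow> 'b::order"
  assumes step: "\<And>i. i < m \<Longrightarrow> x i \<le> x (Suc i)" and "i \<le> j" "j \<le> m"
  shows "x i \<le> x j"
  using assms(2,3)
proof (induction rule: dec_induct)
  case (step n)
  then show ?case using assms(1)[of n] by (auto intro: order_trans)
qed simp

lemma (in finite_measure) nonatomic_split:
  assumes "nonatomic M" "A \<in> sets M" "measure M A > 0"
  obtains B where "B \<in> sets M" "B \<subseteq> A" "0 < measure M B" "measure M B < measure M A"
  using assms unfolding nonatomic_def by (auto simp: emeasure_eq_measure ennreal_less_iff)

text \<open>Repeated halving: when \<open>C\<close> is split into \<open>B\<close> and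
  \<open>C - B\<close>, both of positive measure, one of the two has at most half the measure of
  \<open>C\<close>.\<close>

lemma (in finite_measure) nonatomic_small_subset:
  assumes na: "nonatomic M" and A: "A \<in> sets M" "measure M A > 0" and "e > 0"
  obtains C where "C \<in> sets M" "C \<subseteq> A" "0 < measure M C" "measure M C < e"
proof -
  have "\<exists>C\<in>sets M. C \<subseteq> A \<and> 0 < measure M C \<and> measure M C \<le> measure M A / 2 ^ n" for n
  proof (induction n)
    case 0
    then show ?case using A by auto
  next
    case (Suc n)
    then obtain C where C: "C \<in> sets M" "C \<subseteq> A" "0 < measure M C" "measure M C \<le> measure M A / 2 ^ n"
      by auto
    obtain B where B: "B \<in> sets M" "B \<subseteq> C" "0 < measure M B" "measure M B < measure M C"
      using nonatomic_split[OF na C(1,3)] .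
    have CB: "measure M (C - B) = measure M C - measure M B"
      using B C by (simp add: finite_measure_Diff)
    show ?case
    proof (cases "measure M B \<le> measure M C / 2")
      case True
      then show ?thesis using B C by (intro bexI[of _ B]) auto
    next
      case False
      then show ?thesis using B C CB by (intro bexI[of _ "C - B"]) auto
    qed
  qed
  moreover obtain n where "measure M A / 2 ^ n < e"
    using \<open>e > 0\<close> real_arch_pow[of 2 "measure M A / e"] by (auto simp: field_simps)
  ultimately show thesis using that by (meson le_less_trans)
qed

text \<open>Greedy exhaustion: starting from the empty set, adjoin at each stage a piece of the rest
  of \<open>B\<close> that keeps the measure at most \<open>t\<close> and is at least half as large
  as any other such piece. If the union fell short of \<open>t\<close>, a small set \<open>C\<close>
  of positive measure would have been admissible at every stage, so every increment would be at
  least half of \<open>measure M C\<close>; but the increments tend to 0.\<close>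

theorem (in finite_measure) nonatomic_intermediate_value:
  assumes na: "nonatomic M" and B: "B \<in> sets M" and t: "0 \<le> t" "t \<le> measure M B"
  obtains A where "A \<in> sets M" "A \<subseteq> B" "measure M A = t"
proof -
  \<comment> \<open>\<open>K A\<close> collects the pieces that may be adjoined to \<open>A\<close>
    inside \<open>B\<close> without exceeding \<open>t\<close>.\<close>
  define K where "K A = {C \<in> sets M. C \<subseteq> B - A \<and> measure M C \<le> t - measure M A}" for A
  \<comment> \<open>The supremum of the measures over \<open>K A\<close> is not known to be
    attained, hence the factor 2: some piece exceeds half of a positive supremum, and if the
    supremum is 0 the empty set will do.\<close>
  have "\<exists>C\<in>K A. \<forall>D\<in>K A. measure M D \<le> 2 * measure M C" if "measure M A \<le> t" for A
  proof -
    let ?s = "SUP C\<in>K A. measure M C"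
    have ne: "{} \<in> K A" using that by (auto simp: K_def)
    have bdd: "bdd_above (measure M ` K A)"
      by (rule bdd_aboveI[of _ "t - measure M A"]) (auto simp: K_def)
    show ?thesis
    proof (cases "?s \<le> 0")
      case True
      then have "\<forall>D\<in>K A. measure M D \<le> 0"
        using cSUP_upper[OF _ bdd] by fastforce
      with ne show ?thesis by force
    next
      case False
      then have "?s / 2 < ?s" by simp
      then obtain C where "C \<in> K A" "?s / 2 < measure M C"
        using less_cSUP_iff[OF _ bdd] ne by (metis empty_iff)
      moreover have "measure M D \<le> ?s" if "D \<in> K A" for D
        using cSUP_upper[OF that bdd] .
      ultimately show ?thesis by (intro bexI[of _ C]) force+
    qed
  qed
  then obtain g where g: "\<And>A. measure M A \<le> t \<Longrightarrow> g A \<in> K A"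
    "\<And>A D. measure M A \<le> t \<Longrightarrow> D \<in> K A \<Longrightarrow> measure M D \<le> 2 * measure M (g A)"
    by metis
  define S where "S n = ((\<lambda>A. A \<union> g A) ^^ n) {}" for n
  have S_Suc: "S (Suc n) = S n \<union> g (S n)" for n by (simp add: S_def)
  have S: "S n \<in> sets M \<and> S n \<subseteq> B \<and> measure M (S n) \<le> t
      \<and> measure M (S (Suc n)) = measure M (S n) + measure M (g (S n))" for n
  proof (induction n)
    case 0
    show ?case using t by (simp add: S_def)
  next
    case (Suc n)
    have *: "S (Suc n) \<in> sets M \<and> S (Suc n) \<subseteq> B \<and> measure M (S (Suc n)) \<le> t"
      using Suc g(1)[of "S n"] by (auto simp: S_Suc K_def)
    moreover have "measure M (S (Suc n) \<union> g (S (Suc n))) =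
        measure M (S (Suc n)) + measure M (g (S (Suc n)))"
      using * g(1)[of "S (Suc n)"] by (intro finite_measure_Union) (auto simp: K_def)
    ultimately show ?case by (simp add: S_Suc[of "Suc n"])
  qed
  define A where "A = (\<Union>n. S n)"
  have lim: "(\<lambda>n. measure M (S n)) \<longlonglongrightarrow> measure M A"
    unfolding A_def by (rule finite_Lim_measure_incseq) (auto simp: S S_Suc incseq_Suc_iff)
  have A: "A \<in> sets M" "A \<subseteq> B" using S by (auto simp: A_def)
  have le: "measure M A \<le> t"
    by (rule LIMSEQ_le_const2[OF lim]) (use S in auto)
  have "measure M A = t"
  proof (rule ccontr)
    assume "measure M A \<noteq> t"
    with le have lt: "measure M A < t" by simp
    then have "measure M (B - A) > 0"
      using A B t by (simp add: finite_measure_Diff)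
    then obtain C where C: "C \<in> sets M" "C \<subseteq> B - A" "0 < measure M C" "measure M C < t - measure M A"
      using nonatomic_small_subset[OF na, of "B - A" "t - measure M A"] A B lt by auto
    \<comment> \<open>Since \<open>S n\<close> lies in \<open>A\<close>, a set that fits next to
      \<open>A\<close> also fits next to \<open>S n\<close>, so the greedy choice at stage
      \<open>n\<close> competed with \<open>C\<close>.\<close>
    have "measure M C \<le> 2 * (measure M (S (Suc n)) - measure M (S n))" for n
    proof -
      have "measure M (S n) \<le> measure M A"
        using A by (intro finite_measure_mono) (auto simp: A_def)
      then have "C \<in> K (S n)"
        using C by (auto simp: K_def A_def)
      then show ?thesis using g(2)[of "S n" C] S[of n] by auto
    qed
    moreover have "(\<lambda>n. 2 * (measure M (S (Suc n)) - measure M (S n))) \<longlonglongrightarrow> 2 * (measure M A - measure M A)"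
      by (intro tendsto_intros lim LIMSEQ_Suc)
    ultimately have "measure M C \<le> 2 * (measure M A - measure M A)"
      by (intro LIMSEQ_le_const) auto
    then show False using C by simp
  qed
  with A that show thesis by blast
qed

text \<open>The sets are built one after another: the complement of \<open>S n\<close> contains a
  set whose measure is the next increment of \<open>x\<close>. A chain has to end in the whole
  space, while \<open>x m\<close> may be smaller than the total measure; therefore the chain gets
  one more link, and its length is \<open>Suc m\<close>.\<close>

lemma (in finite_measure) nonatomic_chain:
  assumes na: "nonatomic M" and x: "x 0 = 0" "x m \<le> measure M (space M)"
    and mono: "\<And>i. i < m \<Longrightarrow> x i \<le> x (Suc i)"
  obtains S where "is_chain M S (Suc m)" "\<And>i. i \<le> m \<Longrightarrow> measure M (S i) = x i"
proof -
  have "\<exists>S. is_chain M S (Suc n) \<and> (\<forall>i\<le>n. measure M (S i) = x i)" if "n \<le> m" for n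
    using that
  proof (induction n)
    case 0
    show ?case
      by (rule exI[of _ "\<lambda>i. if i = 0 then {} else space M"]) (simp add: x is_chain_def)
  next
    case (Suc n)
    then obtain S where S: "is_chain M S (Suc n)" "\<And>i. i \<le> n \<Longrightarrow> measure M (S i) = x i"
      by auto
    then have Sn: "S n \<in> sets M" "measure M (S n) = x n"
      by (auto simp: is_chain_def)
    have "x (Suc n) \<le> x m"
      using increasing_upto[of m x "Suc n" m] mono Suc.prems by simp
    then have "x (Suc n) - x n \<le> measure M (space M - S n)"
      using Sn x(2) by (simp add: finite_measure_compl)
    then obtain C where C: "C \<in> sets M" "C \<subseteq> space M - S n" "measure M C = x (Suc n) - x n"
      using nonatomic_intermediate_value[OF na, of "space M - S n" "x (Suc n) - x n"] Sn mono Suc.prems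
      by (metis Suc_le_eq diff_ge_0_iff_ge sets.compl_sets)
    have "measure M (S n \<union> C) = x (Suc n)"
      using C Sn by (subst finite_measure_Union) auto
    with C S Sn show ?case
      using sets.sets_into_space[OF C(1)] sets.sets_into_space[OF Sn(1)]
      \<comment> \<open>The new set is inserted between \<open>S n\<close> and the final
        \<open>space M\<close>.\<close>
      by (intro exI[of _ "\<lambda>i. if i \<le> n then S i else if i = Suc n then S n \<union> C else space M"])
        (auto simp: is_chain_def le_Suc_eq less_Suc_eq)
  qed
  then show thesis using that by blast
qed

section \<open>Absolute continuity of one finite measure with respect to another, off a null
  set\<close>

text \<open>The supremum of \<open>measure M\<close> over the \<open>P\<close>-null sets is attained
  by the union of countably many nearly optimal ones. A further \<open>P\<close>-null set of
  positive \<open>M\<close>-measure, disjoint from this union, could be added to it and would exceed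
  the supremum.\<close>

lemma (in finite_measure) maximal_null_set:
  assumes P: "finite_measure P" and sets_P: "sets P = sets M"
  obtains N where "N \<in> sets M" "measure P N = 0"
    "\<And>E. E \<in> sets M \<Longrightarrow> E \<inter> N = {} \<Longrightarrow> measure P E = 0 \<Longrightarrow> measure M E = 0"
proof -
  interpret P: finite_measure P by fact
  define Z where "Z = {N \<in> sets M. measure P N = 0}"
  let ?s = "SUP N\<in>Z. measure M N"
  have Z_ne: "Z \<noteq> {}" by (auto simp: Z_def)
  have bdd: "bdd_above (measure M ` Z)"
    by (rule bdd_aboveI[of _ "measure M (space M)"]) (auto simp: bounded_measure)
  have "\<exists>N\<in>Z. ?s - inverse (Suc n) < measure M N" for n
    using less_cSUP_iff[OF Z_ne bdd, of "?s - inverse (Suc n)"] by simp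
  then obtain F where F: "\<And>n. F n \<in> Z" "\<And>n. ?s - inverse (Suc n) < measure M (F n)"
    by metis
  define N where "N = (\<Union>n. F n)"
  have null_iff: "E \<in> Z \<longleftrightarrow> E \<in> null_sets P" for E
    by (auto simp: Z_def null_sets_def sets_P P.emeasure_eq_measure)
  have NZ: "N \<in> Z"
    using F(1) unfolding null_iff N_def by auto
  have "?s - inverse (Suc n) \<le> measure M N" for n
  proof -
    have "measure M (F n) \<le> measure M N"
      using NZ by (intro finite_measure_mono) (auto simp: N_def Z_def)
    then show ?thesis using F(2)[of n] by linarith
  qed
  moreover have "(\<lambda>n. ?s - inverse (Suc n)) \<longlonglongrightarrow> ?s - 0"
    by (intro tendsto_intros LIMSEQ_inverse_real_of_nat)
  ultimately have s_le: "?s \<le> measure M N"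
    by (intro LIMSEQ_le_const2[of _ ?s]) auto
  show thesis
  proof
    show "N \<in> sets M" "measure P N = 0" using NZ by (auto simp: Z_def)
    fix E assume E: "E \<in> sets M" "E \<inter> N = {}" "measure P E = 0"
    then have "E \<in> Z" by (simp add: Z_def)
    with NZ have "E \<union> N \<in> Z" unfolding null_iff by auto
    then have "measure M (E \<union> N) \<le> measure M N"
      using cSUP_upper[OF _ bdd] s_le by fastforce
    moreover have "measure M (E \<union> N) = measure M E + measure M N"
      using E NZ by (intro finite_measure_Union) (auto simp: Z_def)
    ultimately show "measure M E = 0"
      using measure_nonneg[of M E] by linarith
  qed
qed

text \<open>With \<open>N\<close> the maximal null set, suppose the claim fails for
  \<open>e\<close>, witnessed by sets \<open>E n\<close>. By Borel-Cantelli their limsup is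
  \<open>P\<close>-null, hence \<open>M\<close>-null off \<open>N\<close>. The tail unions
  \<open>U n\<close> decrease to this limsup, yet \<open>U n - N\<close> has measure at least
  \<open>e\<close> for every \<open>n\<close>, which contradicts continuity from above.\<close>

lemma (in finite_measure) absolutely_continuous_off_null_set:
  assumes P: "finite_measure P" and sets_P: "sets P = sets M"
  obtains N where "N \<in> sets M" "measure P N = 0"
    "\<And>e. e > 0 \<Longrightarrow> \<exists>d>0. \<forall>E\<in>sets M. measure P E < d \<longrightarrow> measure M (E - N) < e"
proof -
  interpret P: finite_measure P by fact
  obtain N where N: "N \<in> sets M" "measure P N = 0"
    "\<And>E. E \<in> sets M \<Longrightarrow> E \<inter> N = {} \<Longrightarrow> measure P E = 0 \<Longrightarrow> measure M E = 0"
    using maximal_null_set[OF assms] by blast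
  show thesis
  proof
    fix e :: real assume "e > 0"
    show "\<exists>d>0. \<forall>E\<in>sets M. measure P E < d \<longrightarrow> measure M (E - N) < e"
    proof (rule ccontr)
      assume "\<not> ?thesis"
      \<comment> \<open>The bounds \<open>(1/2) ^ n\<close> make the \<open>P\<close>-measures
        summable, as Borel-Cantelli requires.\<close>
      then have "\<exists>E\<in>sets M. measure P E < (1/2) ^ n \<and> e \<le> measure M (E - N)" for n
        by (metis not_less zero_less_divide_1_iff zero_less_numeral zero_less_power)
      then obtain E where E: "\<And>n. E n \<in> sets M" "\<And>n. measure P (E n) < (1/2) ^ n"
        "\<And>n. e \<le> measure M (E n - N)"
        by metis
      define U where "U n = (\<Union>k\<in>{n..}. E k)" for n
      have "limsup E \<in> null_sets P"
      proof (rule borel_cantelli_limsup1)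
        show "summable (\<lambda>n. measure P (E n))"
          by (rule summable_comparison_test'[OF summable_geometric[of "1/2"]])
            (use E(2) in \<open>auto intro: less_imp_le\<close>)
      qed (use E(1) sets_P in \<open>simp_all add: P.emeasure_eq_measure\<close>)
      then have lims: "(\<Inter>n. U n) \<in> null_sets P"
        by (simp add: limsup_INF_SUP U_def)
      have "measure M ((\<Inter>n. U n) - N) = 0"
      proof (rule N(3))
        show "(\<Inter>n. U n) - N \<in> sets M" using lims N(1) sets_P by (auto dest: null_setsD2)
        have "(\<Inter>n. U n) - N \<in> null_sets P"
          using lims N(1) sets_P by (auto intro: null_set_Diff)
        then show "measure P ((\<Inter>n. U n) - N) = 0" 
          by (simp add: measure_eq_0_null_sets)
      qed auto
      moreover have "(\<lambda>n. measure M (U n - N)) \<longlonglongrightarrow> measure M (\<Inter>n. U n - N)"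
        by (rule finite_Lim_measure_decseq) (use E(1) N(1) in \<open>auto simp: U_def decseq_def intro: order_trans\<close>)
      moreover have "e \<le> measure M (U n - N)" for n
        using E(1) N(1) by (intro order_trans[OF E(3)[of n]] finite_measure_mono) (auto simp: U_def)
      ultimately have "e \<le> 0"
        by (intro LIMSEQ_le_const[of "\<lambda>n. measure M (U n - N)"]) auto
      with \<open>e > 0\<close> show False by simp
    qed
  qed (use N in auto)
qed

section \<open>Subchains as sets of indices\<close>

lemma is_chain_subset:
  assumes "is_chain M S m" "i \<le> j" "j \<le> m"
  shows "S i \<subseteq> S j"
  using assms by (intro increasing_upto[of m S i j]) (auto simp: is_chain_def)

text \<open>A subchain is a set of pairs, so two indices may name the same link. This happens only
  for links \<open>(A, A)\<close>: if \<open>S i = S j\<close> with \<open>i < j\<close>, then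
  \<open>S (Suc i)\<close> is squeezed between them. Such links contribute 0, so counting them
  repeatedly does not change the sum.\<close>

lemma subchain_norm_links:
  assumes "is_chain M S m" "I \<subseteq> {..<m}"
  shows "subchain_norm \<nu> ((\<lambda>i. (S i, S (Suc i))) ` I) = (\<Sum>i\<in>I. \<bar>\<nu> (S (Suc i)) - \<nu> (S i)\<bar>)"
proof -
  note mono = is_chain_subset[OF assms(1)]
  have degenerate: "S (Suc i) = S i" if "i < j" "j < m" "S i = S j" for i j
    using mono[of "Suc i" j] mono[of i "Suc i"] that by auto
  have "S (Suc i) = S i" if "i \<in> I" "j \<in> I" "i \<noteq> j" "S i = S j" "S (Suc i) = S (Suc j)" for i j
    using degenerate[of i j] degenerate[of j i] that assms(2) by (cases i j rule: linorder_cases) auto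
  note degenerate = this
  have "finite I" using assms(2) finite_subset by blast
  then show ?thesis
    unfolding subchain_norm_def
  proof (subst sum.reindex_nontrivial)
    fix i j assume "i \<in> I" "j \<in> I" "i \<noteq> j" "(S i, S (Suc i)) = (S j, S (Suc j))"
    then have "S (Suc i) = S i" by (intro degenerate) auto
    then show "(case (S i, S (Suc i)) of (A, B) \<Rightarrow> \<bar>\<nu> B - \<nu> A\<bar>) = 0" by simp
  qed simp_all
qed

lemma links_eq_image: "links S m = (\<lambda>i. (S i, S (Suc i))) ` {..<m}"
  by (auto simp: links_def)

text \<open>Every subchain is the image of an index set. Working with indices allows the sets of a
  chain to be modified while the selected positions stay fixed.\<close>

lemma ac4_iff_indices:
  "ac4 M \<nu> \<mu> \<longleftrightarrow>
     (\<forall>\<epsilon>>0. \<exists>\<delta>>0. \<forall>S m I. is_chain M S m \<longrightarrow> I \<subseteq> {..<m} \<longrightarrow>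
        (\<Sum>i\<in>I. \<bar>measure \<mu> (S (Suc i)) - measure \<mu> (S i)\<bar>) < \<delta> \<longrightarrow>
        (\<Sum>i\<in>I. \<bar>\<nu> (S (Suc i)) - \<nu> (S i)\<bar>) < \<epsilon>)"
proof -
  have "(\<forall>\<Lambda>. is_chain M S m \<longrightarrow> \<Lambda> \<subseteq> links S m \<longrightarrow>
        subchain_norm (measure \<mu>) \<Lambda> < \<delta> \<longrightarrow> subchain_norm \<nu> \<Lambda> < \<epsilon>) \<longleftrightarrow>
     (\<forall>I. is_chain M S m \<longrightarrow> I \<subseteq> {..<m} \<longrightarrow>
        (\<Sum>i\<in>I. \<bar>measure \<mu> (S (Suc i)) - measure \<mu> (S i)\<bar>) < \<delta> \<longrightarrow>
        (\<Sum>i\<in>I. \<bar>\<nu> (S (Suc i)) - \<nu> (S i)\<bar>) < \<epsilon>)" for S m \<delta> \<epsilon>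
  proof (cases "is_chain M S m")
    case True
    then show ?thesis
      unfolding links_eq_image by (simp add: all_subset_image subchain_norm_links[OF True] cong: imp_cong)
  qed simp
  then show ?thesis unfolding ac4_def by simp
qed

section \<open>Absolute continuity of a real function along increasing sequences\<close>

lemma absolutely_continuous_fun_chainD:
  assumes f: "absolutely_continuous_fun a b f" and "e > 0"
  obtains d where "d > 0"
    "\<And>x m I. \<lbrakk>a \<le> x 0; x m \<le> b; \<forall>i<m. x i \<le> x (Suc i); I \<subseteq> {..<m};
        (\<Sum>i\<in>I. x (Suc i) - x i) < d\<rbrakk> \<Longrightarrow> (\<Sum>i\<in>I. \<bar>f (x (Suc i)) - f (x i)\<bar>) < e"
proof -
  obtain d where d: "d > 0" and *: "\<forall>(n::nat) u v. (\<forall>i<n. a \<le> u i \<and> u i \<le> v i \<and> v i \<le> b) \<longrightarrow>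
      disjoint_family_on (\<lambda>i. {u i<..<v i}) {..<n} \<longrightarrow> (\<Sum>i<n. v i - u i) < d \<longrightarrow>
      (\<Sum>i<n. \<bar>f (v i) - f (u i)\<bar>) < e"
    using assms unfolding absolutely_continuous_fun_def by blast
  show thesis
  proof (rule that[OF d])
    fix x :: "nat \<Rightarrow> real" and m I
    assume x: "a \<le> x 0" "x m \<le> b" "\<forall>i<m. x i \<le> x (Suc i)" and I: "I \<subseteq> {..<m}"
      and lt: "(\<Sum>i\<in>I. x (Suc i) - x i) < d"
    have mono: "x i \<le> x j" if "i \<le> j" "j \<le> m" for i j
      using increasing_upto[of m x i j] x that by simp
    \<comment> \<open>The definition of absolute continuity takes intervals indexed by an initial
      segment, so all \<open>m\<close> steps are kept and those outside \<open>I\<close> are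
      collapsed to a point.\<close>
    define v where "v i = (if i \<in> I then x (Suc i) else x i)" for i
    \<comment> \<open>Used twice, for the lengths \<open>y - z\<close> and for the increments of
      \<open>f\<close>.\<close>
    have sum_eq: "(\<Sum>i<m. g (v i) (x i)) = (\<Sum>i\<in>I. g (x (Suc i)) (x i))"
      if "\<And>y. g y y = 0" for g :: "real \<Rightarrow> real \<Rightarrow> real"
      by (rule sum.mono_neutral_cong_right) (use I that in \<open>auto simp: v_def\<close>)
    have "(\<Sum>i<m. \<bar>f (v i) - f (x i)\<bar>) < e"
    proof (rule *[rule_format])
      have "a \<le> x i \<and> x i \<le> b" if "i \<le> m" for i
        using mono[of 0 i] mono[of i m] x that by auto
      then show "a \<le> x i \<and> x i \<le> v i \<and> v i \<le> b" if "i < m" for i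
        using x that by (auto simp: v_def)
      have "{x i<..<v i} \<inter> {x j<..<v j} = {}" if "i < j" "j < m" for i j
        using mono[of "Suc i" j] mono[of i j] that by (auto simp: v_def)
      then have "{x i<..<v i} \<inter> {x j<..<v j} = {}" if "i \<noteq> j" "i < m" "j < m" for i j
        using that by (metis Int_commute linorder_neqE_nat)
      then show "disjoint_family_on (\<lambda>i. {x i<..<v i}) {..<m}"
        unfolding disjoint_family_on_def by blast
      show "(\<Sum>i<m. v i - x i) < d"
        using sum_eq[of "\<lambda>y z. y - z"] lt by simp
    qed
    then show "(\<Sum>i\<in>I. \<bar>f (x (Suc i)) - f (x i)\<bar>) < e"
      using sum_eq[of "\<lambda>y z. \<bar>f y - f z\<bar>"] by simp
  qed
qed

text \<open>Sorting the endpoints of finitely many disjoint nondegenerate intervals gives an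
  increasing sequence. By disjointness no endpoint lies strictly inside one of the intervals, so
  each interval is a step between neighbours of this sequence.\<close>

lemma absolutely_continuous_funI_chain:
  assumes chain: "\<And>e. e > 0 \<Longrightarrow> \<exists>d>0. \<forall>x m I. x 0 = a \<longrightarrow> x m \<le> b \<longrightarrow> (\<forall>i<m. x i \<le> x (Suc i)) \<longrightarrow>
      I \<subseteq> {..<m} \<longrightarrow> (\<Sum>i\<in>I. x (Suc i) - x i) < d \<longrightarrow> (\<Sum>i\<in>I. \<bar>f (x (Suc i)) - f (x i)\<bar>) < e"
    and "a \<le> b"
  shows "absolutely_continuous_fun a b f"
  unfolding absolutely_continuous_fun_def
proof (intro allI impI)
  fix e :: real assume "e > 0"
  then obtain d where "d > 0" and d: "\<forall>x m I. x 0 = a \<longrightarrow> x m \<le> b \<longrightarrow> (\<forall>i<m. x i \<le> x (Suc i)) \<longrightarrow>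
      I \<subseteq> {..<m} \<longrightarrow> (\<Sum>i\<in>I. x (Suc i) - x i) < d \<longrightarrow> (\<Sum>i\<in>I. \<bar>f (x (Suc i)) - f (x i)\<bar>) < e"
    using chain by blast
  have "(\<Sum>i<n. \<bar>f (v i) - f (u i)\<bar>) < e"
    if bounds: "\<forall>i<n. a \<le> u i \<and> u i \<le> v i \<and> v i \<le> b"
      and disj: "disjoint_family_on (\<lambda>i. {u i<..<v i}) {..<n}"
      and lt: "(\<Sum>i<n. v i - u i) < d" for n :: nat and u v
  proof -
    \<comment> \<open>Degenerate intervals are left out: their open intervals are empty, so
      disjointness does not prevent their endpoint from lying inside another interval.\<close>
    define J where "J = {i. i < n \<and> u i < v i}"
    \<comment> \<open>The point \<open>a\<close> makes the sorted list nonempty and lets it start at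
      \<open>a\<close>, as \<open>chain\<close> demands.\<close>
    define X where "X = insert a (u ` J \<union> v ` J)"
    define xs where "xs = sorted_list_of_set X"
    have fin: "finite J" "finite X" by (auto simp: J_def X_def)
    have sep: "v i \<le> u j \<or> v j \<le> u i" if "i \<in> J" "j \<in> J" "i \<noteq> j" for i j
    proof (rule ccontr)
      assume "\<not> ?thesis"
      \<comment> \<open>The midpoint of the overlap of the two intervals.\<close>
      with that have "(max (u i) (u j) + min (v i) (v j)) / 2 \<in> {u i<..<v i} \<inter> {u j<..<v j}"
        by (auto simp: J_def max_def min_def field_simps)
      moreover have "{u i<..<v i} \<inter> {u j<..<v j} = {}"
        using disj that unfolding disjoint_family_on_def J_def by auto
      ultimately show False by blast
    qed
    have set_xs: "set xs = X" using fin by (simp add: xs_def)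
    have X_bounds: "a \<le> y" "y \<le> b" if "y \<in> X" for y
      using that bounds \<open>a \<le> b\<close> by (auto simp: X_def J_def intro: order_trans)
    have ne: "xs \<noteq> []" using set_xs by (auto simp: X_def)
    have less: "xs ! i < xs ! j" if "i < j" "j < length xs" for i j
      using strict_sorted_list_of_set[of X] that unfolding xs_def by (rule sorted_wrt_nth_less)
    have x0: "xs ! 0 = a"
    proof -
      obtain k where k: "k < length xs" "xs ! k = a"
        using set_xs by (metis X_def in_set_conv_nth insertI1)
      have "a \<le> xs ! 0" using X_bounds(1) set_xs ne by (metis length_greater_0_conv nth_mem)
      then show ?thesis using less[of 0 k] k by (cases "k = 0") auto
    qed
    have "\<exists>k. Suc k < length xs \<and> xs ! k = u i \<and> xs ! Suc k = v i" if i: "i \<in> J" for i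
    proof -
      obtain k l where kl: "k < length xs" "xs ! k = u i" "l < length xs" "xs ! l = v i"
        using set_xs i unfolding X_def by (metis UnI1 UnI2 imageI in_set_conv_nth insertI2)
      have "u i < v i" using i by (simp add: J_def)
      then have "k < l" using kl less[of l k] by (cases k l rule: linorder_cases) auto
      \<comment> \<open>A list element strictly between \<open>u i\<close> and \<open>v i\<close>
        exceeds \<open>a\<close>, so it is an endpoint of another interval of \<open>J\<close>,
        which contradicts \<open>sep\<close>.\<close>
      moreover have "\<not> Suc k < l"
      proof
        assume *: "Suc k < l"
        let ?y = "xs ! Suc k"
        have y: "u i < ?y" "?y < v i" using less[of k "Suc k"] less[of "Suc k" l] * kl by auto
        have "?y \<in> X" using * kl set_xs by (metis less_trans nth_mem)
        moreover have "a \<le> u i" using bounds i by (auto simp: J_def)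
        ultimately obtain j where "j \<in> J" "?y = u j \<or> ?y = v j"
          using y by (auto simp: X_def)
        moreover from this have "i \<noteq> j" using y by auto
        ultimately show False using sep[OF i, of j] y by (auto simp: J_def)
      qed
      ultimately have "l = Suc k" by simp
      with kl show ?thesis by blast
    qed
    then obtain h where h: "\<And>i. i \<in> J \<Longrightarrow> Suc (h i) < length xs" "\<And>i. i \<in> J \<Longrightarrow> xs ! h i = u i"
      "\<And>i. i \<in> J \<Longrightarrow> xs ! Suc (h i) = v i"
      by metis
    have inj: "inj_on h J"
    proof (rule inj_onI, rule ccontr)
      fix i j assume "i \<in> J" "j \<in> J" "h i = h j" "i \<noteq> j"
      then show False using sep[of i j] h(2)[of i] h(2)[of j] by (auto simp: J_def)
    qed
    have sum_eq: "(\<Sum>k\<in>h ` J. g (xs ! Suc k) (xs ! k)) = (\<Sum>i<n. g (v i) (u i))"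
      if "\<And>y. g y y = 0" for g :: "real \<Rightarrow> real \<Rightarrow> real"
    proof -
      have "(\<Sum>k\<in>h ` J. g (xs ! Suc k) (xs ! k)) = (\<Sum>i\<in>J. g (v i) (u i))"
        using inj by (simp add: sum.reindex h)
      also have "\<dots> = (\<Sum>i<n. g (v i) (u i))"
      proof (rule sum.mono_neutral_left)
        have "v i = u i" if "i < n" "i \<notin> J" for i
          using that bounds by (force simp: J_def)
        then show "\<forall>i\<in>{..<n} - J. g (v i) (u i) = 0" using that by simp
      qed (auto simp: J_def)
      finally show ?thesis .
    qed
    have "(\<Sum>k\<in>h ` J. \<bar>f (xs ! Suc k) - f (xs ! k)\<bar>) < e"
    proof (rule d[rule_format, of "\<lambda>i. xs ! i" "length xs - 1"])
      show "xs ! (length xs - 1) \<le> b"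
        using X_bounds(2) set_xs ne by (metis last_conv_nth last_in_set)
      show "xs ! i \<le> xs ! Suc i" if "i < length xs - 1" for i
        using less[of i "Suc i"] that by (intro less_imp_le) auto
      show "h ` J \<subseteq> {..<length xs - 1}" using h(1) by force
      show "(\<Sum>k\<in>h ` J. xs ! Suc k - xs ! k) < d"
        using sum_eq[of "\<lambda>y z. y - z"] lt by simp
    qed (rule x0)
    then show ?thesis using sum_eq[of "\<lambda>y z. \<bar>f y - f z\<bar>"] by simp
  qed
  with \<open>d > 0\<close> show "\<exists>\<delta>>0. \<forall>(n::nat) u v. (\<forall>i<n. a \<le> u i \<and> u i \<le> v i \<and> v i \<le> b) \<longrightarrow>
      disjoint_family_on (\<lambda>i. {u i<..<v i}) {..<n} \<longrightarrow> (\<Sum>i<n. v i - u i) < \<delta> \<longrightarrow>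
      (\<Sum>i<n. \<bar>f (v i) - f (u i)\<bar>) < e"
    by blast
qed

section \<open>Values and chains of the measures in \<open>NA_plus M\<close>\<close>

lemma NA_plusD:
  assumes "P \<in> NA_plus M"
  shows "finite_measure P" "nonatomic P" "sets P = sets M" "space P = space M"
  using assms sets_eq_imp_space_eq by (auto simp: NA_plus_def)

lemma NA_plus_range:
  assumes "P \<in> NA_plus M"
  shows "measure P ` sets M = {0..measure P (space M)}"
proof -
  interpret finite_measure P using NA_plusD[OF assms] by simp
  note P = NA_plusD[OF assms]
  have "\<exists>A\<in>sets M. measure P A = t" if "t \<in> {0..measure P (space M)}" for t
    using nonatomic_intermediate_value[OF P(2), of "space M" t] that P by auto
  then show ?thesis
    using bounded_measure P by (auto simp: image_iff) metis
qed

lemma NA_plus_nested_range: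
  assumes P: "P \<in> NA_plus M" and xy: "0 \<le> x" "x \<le> y" "y \<le> measure P (space M)"
  obtains A B where "A \<in> sets M" "B \<in> sets M" "A \<subseteq> B" "measure P A = x" "measure P B = y"
proof -
  interpret finite_measure P using NA_plusD[OF P] by simp
  obtain B where B: "B \<in> sets M" "measure P B = y"
    using NA_plus_range[OF P] xy by (metis atLeastAtMost_iff imageE order_trans)
  then obtain A where "A \<in> sets M" "A \<subseteq> B" "measure P A = x"
    using nonatomic_intermediate_value[of B x] NA_plusD[OF P] xy by auto
  with B that show thesis by blast
qed

lemma NA_plus_chain:
  assumes P: "P \<in> NA_plus M" and x: "x 0 = 0" "x m \<le> measure P (space M)" "\<forall>i<m. x i \<le> x (Suc i)"
  obtains S where "is_chain M S (Suc m)" "\<And>i. i \<le> m \<Longrightarrow> measure P (S i) = x i"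
proof -
  interpret finite_measure P using NA_plusD[OF P] by simp
  show thesis
    using nonatomic_chain[of x m] NA_plusD[OF P] x that by (auto simp: is_chain_def)
qed

lemma NA_plus_chain_mono:
  assumes P: "P \<in> NA_plus M" and S: "is_chain M S m"
  shows "measure P (S 0) = 0" "measure P (S m) = measure P (space M)"
    "\<And>i. i < m \<Longrightarrow> measure P (S i) \<le> measure P (S (Suc i))"
proof -
  interpret finite_measure P using NA_plusD[OF P] by simp
  show "measure P (S 0) = 0" "measure P (S m) = measure P (space M)"
    using S by (auto simp: is_chain_def)
  show "\<And>i. i < m \<Longrightarrow> measure P (S i) \<le> measure P (S (Suc i))"
    using S NA_plusD[OF P] by (intro finite_measure_mono) (auto simp: is_chain_def)
qed

text \<open>The form used in all the transfers below: deleting \<open>N\<close> from a set is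
  invisible to \<open>P\<close>, and what is left has small \<open>\<mu>\<close>-measure as soon as
  the \<open>P\<close>-measure is small.\<close>

lemma NA_plus_off_null_set:
  assumes P: "P \<in> NA_plus M" and \<mu>: "\<mu> \<in> NA_plus M"
  obtains N where "N \<in> sets M" "\<And>A. A \<in> sets M \<Longrightarrow> measure P (A - N) = measure P A"
    "\<And>e. e > 0 \<Longrightarrow> \<exists>d>0. \<forall>E\<in>sets M. measure P E < d \<longrightarrow> measure \<mu> (E - N) < e"
proof -
  note P = NA_plusD[OF P] and \<mu> = NA_plusD[OF \<mu>]
  interpret P: finite_measure P by (rule P)
  interpret \<mu>: finite_measure \<mu> by (rule \<mu>)
  obtain N where N: "N \<in> sets M" "measure P N = 0"
    "\<And>e. e > 0 \<Longrightarrow> \<exists>d>0. \<forall>E\<in>sets M. measure P E < d \<longrightarrow> measure \<mu> (E - N) < e"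
    using \<mu>.absolutely_continuous_off_null_set[OF P(1)] P \<mu> by auto
  have "N \<in> null_sets P" using N P by (simp add: null_sets_def P.emeasure_eq_measure)
  then have "measure P (A - N) = measure P A" if "A \<in> sets M" for A
    using that P by (simp add: measure_Diff_null_set)
  with N that show thesis by blast
qed

section \<open>Passing from an arbitrary dominating measure to \<open>P\<close>\<close>

lemma ac2_transfer:
  assumes P: "P \<in> NA_plus M" and \<mu>: "\<mu> \<in> NA_plus M" and ac: "ac2 M (f \<circ> measure P) \<mu>"
  shows "ac2 M (f \<circ> measure P) P"
  unfolding ac2_def
proof (intro allI impI)
  fix e :: real assume "e > 0"
  then obtain d where "d > 0" and d: "\<And>E. E \<in> sets M \<Longrightarrow> measure \<mu> E < d \<Longrightarrow> \<bar>f (measure P E)\<bar> < e"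
    using ac unfolding ac2_def by auto
  obtain N where N: "N \<in> sets M" "\<And>A. A \<in> sets M \<Longrightarrow> measure P (A - N) = measure P A"
    "\<And>e. e > 0 \<Longrightarrow> \<exists>d>0. \<forall>E\<in>sets M. measure P E < d \<longrightarrow> measure \<mu> (E - N) < e"
    using NA_plus_off_null_set[OF P \<mu>] by blast
  obtain d' where d': "d' > 0" "\<And>E. E \<in> sets M \<Longrightarrow> measure P E < d' \<Longrightarrow> measure \<mu> (E - N) < d"
    using N(3)[OF \<open>d > 0\<close>] by blast
  have "\<bar>f (measure P E)\<bar> < e" if "E \<in> sets M" "measure P E < d'" for E
    using d[of "E - N"] d'(2)[OF that] N that by auto
  then show "\<exists>\<delta>>0. \<forall>E\<in>sets M. \<bar>measure P E\<bar> < \<delta> \<longrightarrow> \<bar>(f \<circ> measure P) E\<bar> < e"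
    using d'(1) by auto
qed

text \<open>The hypothesis is applied to \<open>A - N\<close> and \<open>B - N\<close>: their
  symmetric difference is that of \<open>A\<close> and \<open>B\<close> with \<open>N\<close>
  removed, and \<open>f \<circ> measure P\<close> keeps its values.\<close>

lemma ac3_transfer:
  assumes P: "P \<in> NA_plus M" and \<mu>: "\<mu> \<in> NA_plus M" and ac: "ac3 M (f \<circ> measure P) \<mu>"
  shows "ac3 M (f \<circ> measure P) P"
  unfolding ac3_def
proof (intro allI impI)
  fix e :: real assume "e > 0"
  then obtain d where "d > 0" and d: "\<forall>A\<in>sets M. \<forall>B\<in>sets M. measure \<mu> (sym_diff A B) < d \<longrightarrow>
      \<bar>f (measure P A) - f (measure P B)\<bar> < e"
    using ac unfolding ac3_def comp_def by blast
  obtain N where N: "N \<in> sets M" "\<And>A. A \<in> sets M \<Longrightarrow> measure P (A - N) = measure P A"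
    "\<And>e. e > 0 \<Longrightarrow> \<exists>d>0. \<forall>E\<in>sets M. measure P E < d \<longrightarrow> measure \<mu> (E - N) < e"
    using NA_plus_off_null_set[OF P \<mu>] by blast
  obtain d' where d': "d' > 0" "\<And>E. E \<in> sets M \<Longrightarrow> measure P E < d' \<Longrightarrow> measure \<mu> (E - N) < d"
    using N(3)[OF \<open>d > 0\<close>] by blast
  have "\<bar>f (measure P A) - f (measure P B)\<bar> < e"
    if "A \<in> sets M" "B \<in> sets M" "measure P (sym_diff A B) < d'" for A B
  proof -
    have "sym_diff (A - N) (B - N) = sym_diff A B - N" by blast
    then show ?thesis
      using d[rule_format, of "A - N" "B - N"] d'(2)[of "sym_diff A B"] N that by auto
  qed
  then show "\<exists>\<delta>>0. \<forall>A\<in>sets M. \<forall>B\<in>sets M. measure P (sym_diff A B) < \<delta> \<longrightarrow>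
      \<bar>(f \<circ> measure P) A - (f \<circ> measure P) B\<bar> < e"
    using d'(1) by auto
qed

text \<open>Turns the variation of a measure over a subchain into the measure of one set, so that
  smallness conditions on single sets apply to subchains.\<close>

lemma (in finite_measure) measure_UN_chain_diff:
  assumes S: "is_chain M S m" and I: "I \<subseteq> {..<m}"
  shows "measure M (\<Union>i\<in>I. S (Suc i) - S i) = (\<Sum>i\<in>I. \<bar>measure M (S (Suc i)) - measure M (S i)\<bar>)"
proof -
  note mono = is_chain_subset[OF S]
  have "(S (Suc i) - S i) \<inter> (S (Suc j) - S j) = {}" if "i < j" "j < m" for i j
    using mono[of "Suc i" j] that by auto
  then have "(S (Suc i) - S i) \<inter> (S (Suc j) - S j) = {}" if "i \<noteq> j" "i < m" "j < m" for i j
    using that by (metis Int_commute linorder_neqE_nat)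
  then have "disjoint_family_on (\<lambda>i. S (Suc i) - S i) I"
    unfolding disjoint_family_on_def using I by blast
  then have "measure M (\<Union>i\<in>I. S (Suc i) - S i) = (\<Sum>i\<in>I. measure M (S (Suc i) - S i))"
    using S I finite_subset[OF I]
    by (intro finite_measure_finite_Union) (auto simp: is_chain_def image_subset_iff Suc_leI intro!: sets.Diff)
  also have "\<dots> = (\<Sum>i\<in>I. \<bar>measure M (S (Suc i)) - measure M (S i)\<bar>)"
  proof (rule sum.cong)
    fix i assume "i \<in> I"
    then have "S i \<subseteq> S (Suc i)" "S i \<in> sets M" "S (Suc i) \<in> sets M"
      using S I by (auto simp: is_chain_def Suc_leI)
    then show "measure M (S (Suc i) - S i) = \<bar>measure M (S (Suc i)) - measure M (S i)\<bar>"
      by (simp add: finite_measure_Diff finite_measure_mono)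
  qed simp
  finally show ?thesis .
qed

lemma ac4_transfer:
  assumes P: "P \<in> NA_plus M" and \<mu>: "\<mu> \<in> NA_plus M" and ac: "ac4 M (f \<circ> measure P) \<mu>"
  shows "ac4 M (f \<circ> measure P) P"
  unfolding ac4_iff_indices
proof (intro allI impI)
  fix e :: real assume "e > 0"
  then obtain d where "d > 0" and d: "\<forall>S m I. is_chain M S m \<longrightarrow> I \<subseteq> {..<m} \<longrightarrow>
      (\<Sum>i\<in>I. \<bar>measure \<mu> (S (Suc i)) - measure \<mu> (S i)\<bar>) < d \<longrightarrow>
      (\<Sum>i\<in>I. \<bar>f (measure P (S (Suc i))) - f (measure P (S i))\<bar>) < e"
    using ac unfolding ac4_iff_indices comp_def by blast
  obtain N where N: "N \<in> sets M" "\<And>A. A \<in> sets M \<Longrightarrow> measure P (A - N) = measure P A"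
    "\<And>e. e > 0 \<Longrightarrow> \<exists>d>0. \<forall>E\<in>sets M. measure P E < d \<longrightarrow> measure \<mu> (E - N) < e"
    using NA_plus_off_null_set[OF P \<mu>] by blast
  obtain d' where d': "d' > 0" "\<And>E. E \<in> sets M \<Longrightarrow> measure P E < d' \<Longrightarrow> measure \<mu> (E - N) < d"
    using N(3)[OF \<open>d > 0\<close>] by blast
  interpret P: finite_measure P using NA_plusD[OF P] by simp
  interpret \<mu>: finite_measure \<mu> using NA_plusD[OF \<mu>] by simp
  \<comment> \<open>A chain depends on the measurable space only, so the lemmas about
    \<open>P\<close> and \<open>\<mu>\<close> apply to chains of \<open>M\<close>.\<close>
  have chain_P: "is_chain P = is_chain M" and chain_\<mu>: "is_chain \<mu> = is_chain M"
    using NA_plusD[OF P] NA_plusD[OF \<mu>] by (auto simp: is_chain_def fun_eq_iff)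
  have "(\<Sum>i\<in>I. \<bar>f (measure P (S (Suc i))) - f (measure P (S i))\<bar>) < e"
    if S: "is_chain M S m" and I: "I \<subseteq> {..<m}"
      and lt: "(\<Sum>i\<in>I. \<bar>measure P (S (Suc i)) - measure P (S i)\<bar>) < d'" for S m I
  proof -
    \<comment> \<open>Removing \<open>N\<close> throughout leaves a sequence that ends in
      \<open>space M - N\<close>; appending \<open>space M\<close> makes it a chain again, and the
      new last link has index \<open>m\<close>, which is not in \<open>I\<close>.\<close>
    define T where "T i = (if i \<le> m then S i - N else space M)" for i
    have T: "is_chain M T (Suc m)"
      using S N(1) sets.sets_into_space unfolding T_def is_chain_def by (auto simp: less_Suc_eq)
    have S_sets: "S i \<in> sets M" "S (Suc i) \<in> sets M" if "i \<in> I" for i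
      using S I that by (auto simp: is_chain_def Suc_leI)
    have T_I: "T i = S i - N" "T (Suc i) = S (Suc i) - N" if "i \<in> I" for i
      using I that by (auto simp: T_def)
    have "(\<Union>i\<in>I. T (Suc i) - T i) = (\<Union>i\<in>I. S (Suc i) - S i) - N"
      using T_I by auto
    moreover have "(\<Union>i\<in>I. S (Suc i) - S i) \<in> sets M"
      using S_sets finite_subset[OF I] by (intro sets.finite_UN) auto
    moreover have "measure P (\<Union>i\<in>I. S (Suc i) - S i) < d'"
      using P.measure_UN_chain_diff[of S m I] chain_P S I lt by simp
    ultimately have "measure \<mu> (\<Union>i\<in>I. T (Suc i) - T i) < d"
      using d'(2) by simp
    then have "(\<Sum>i\<in>I. \<bar>measure \<mu> (T (Suc i)) - measure \<mu> (T i)\<bar>) < d"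
      using \<mu>.measure_UN_chain_diff[of T "Suc m" I] chain_\<mu> T I by force
    then have "(\<Sum>i\<in>I. \<bar>f (measure P (T (Suc i))) - f (measure P (T i))\<bar>) < e"
      using T I by (intro d[rule_format, of T "Suc m"]) auto
    then show ?thesis
      using N(2) S_sets T_I by simp
  qed
  then show "\<exists>\<delta>>0. \<forall>S m I. is_chain M S m \<longrightarrow> I \<subseteq> {..<m} \<longrightarrow>
      (\<Sum>i\<in>I. \<bar>measure P (S (Suc i)) - measure P (S i)\<bar>) < \<delta> \<longrightarrow>
      (\<Sum>i\<in>I. \<bar>(f \<circ> measure P) (S (Suc i)) - (f \<circ> measure P) (S i)\<bar>) < e"
    using d'(1) by auto
qed

section \<open>Properties of the game \<open>f \<circ> measure P\<close> in terms of
  \<open>f\<close>\<close>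

lemma ac1_comp: "ac1 M (f \<circ> measure P) P"
  by (auto simp: ac1_def null_coalitions_def)

text \<open>The values of \<open>P\<close> fill the whole interval, so quantifying over sets amounts
  to quantifying over points \<open>t\<close>; with \<open>f 0 = 0\<close> this is the epsilon-delta
  condition at 0.\<close>

lemma ac2_comp_iff:
  assumes P: "P \<in> NA_plus M" and "f 0 = 0"
  shows "ac2 M (f \<circ> measure P) P \<longleftrightarrow> continuous (at 0 within {0..measure P (space M)}) f"
proof -
  have "ac2 M (f \<circ> measure P) P \<longleftrightarrow> (\<forall>e>0. \<exists>d>0. \<forall>t\<in>measure P ` sets M. \<bar>t\<bar> < d \<longrightarrow> \<bar>f t\<bar> < e)"
    by (simp add: ac2_def)
  then show ?thesis
    unfolding NA_plus_range[OF P] continuous_within_eps_delta using \<open>f 0 = 0\<close> by (simp add: dist_real_def)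
qed

lemma ac3_comp_iff:
  assumes P: "P \<in> NA_plus M"
  shows "ac3 M (f \<circ> measure P) P \<longleftrightarrow> continuous_on {0..measure P (space M)} f"
proof
  interpret finite_measure P using NA_plusD[OF P] by simp
  note sets_P = NA_plusD(3)[OF P]
  let ?p = "measure P (space M)"
  show "continuous_on {0..?p} f" if ac: "ac3 M (f \<circ> measure P) P"
    unfolding continuous_on_iff
  proof (intro ballI allI impI)
    fix x e :: real assume x: "x \<in> {0..?p}" and "e > 0"
    then obtain d where "d > 0" and d: "\<forall>A\<in>sets M. \<forall>B\<in>sets M. measure P (sym_diff A B) < d \<longrightarrow>
        \<bar>f (measure P A) - f (measure P B)\<bar> < e"
      using ac unfolding ac3_def comp_def by blast
    \<comment> \<open>Nested sets with measures \<open>y\<close> and \<open>z\<close> have a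
      symmetric difference of measure exactly \<open>z - y\<close>.\<close>
    have le: "\<bar>f y - f z\<bar> < e" if yz: "0 \<le> y" "y \<le> z" "z \<le> ?p" "z - y < d" for y z
    proof -
      obtain A B where AB: "A \<in> sets M" "B \<in> sets M" "A \<subseteq> B" "measure P A = y" "measure P B = z"
        using NA_plus_nested_range[OF P yz(1-3)] .
      have "sym_diff A B = B - A" using AB by blast
      then have "measure P (sym_diff A B) < d"
        using AB sets_P yz by (simp add: finite_measure_Diff)
      then show ?thesis using d[rule_format, OF AB(1,2)] AB by simp
    qed
    have "dist (f y) (f x) < e" if "y \<in> {0..?p}" "dist y x < d" for y
      using le[of x y] le[of y x] that x by (cases "x \<le> y") (auto simp: dist_real_def abs_minus_commute)
    with \<open>d > 0\<close> show "\<exists>d>0. \<forall>y\<in>{0..?p}. dist y x < d \<longrightarrow> dist (f y) (f x) < e"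
      by blast
  qed
  show "ac3 M (f \<circ> measure P) P" if cont: "continuous_on {0..?p} f"
    unfolding ac3_def
  proof (intro allI impI)
    fix e :: real assume "e > 0"
    \<comment> \<open>\<open>ac3\<close> asks for one bound that serves all pairs of sets, hence
      uniform continuity, which compactness of the interval provides.\<close>
    moreover have "uniformly_continuous_on {0..?p} f"
      using cont by (intro compact_uniformly_continuous) auto
    ultimately obtain d where "d > 0" and d: "\<And>y z. \<lbrakk>y \<in> {0..?p}; z \<in> {0..?p}; \<bar>y - z\<bar> < d\<rbrakk> \<Longrightarrow> \<bar>f y - f z\<bar> < e"
      unfolding uniformly_continuous_on_def dist_real_def by (metis abs_minus_commute)
    have "\<bar>f (measure P A) - f (measure P B)\<bar> < e"
      if AB: "A \<in> sets M" "B \<in> sets M" "measure P (sym_diff A B) < d" for A B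
    proof (rule d)
      show "measure P A \<in> {0..?p}" "measure P B \<in> {0..?p}"
        using NA_plus_range[OF P] AB by auto
      have "measure P A \<le> measure P (sym_diff A B) + measure P B" 
        using AB sets_P by (intro order_trans[OF finite_measure_mono measure_Un_le]) auto
      moreover have "measure P B \<le> measure P (sym_diff A B) + measure P A" 
        using AB sets_P by (intro order_trans[OF finite_measure_mono measure_Un_le]) auto
      ultimately show "\<bar>measure P A - measure P B\<bar> < d" using AB by linarith
    qed
    with \<open>d > 0\<close> show "\<exists>\<delta>>0. \<forall>A\<in>sets M. \<forall>B\<in>sets M. measure P (sym_diff A B) < \<delta> \<longrightarrow>
        \<bar>(f \<circ> measure P) A - (f \<circ> measure P) B\<bar> < e"
      by auto
  qed
qed

text \<open>Measuring the sets of a chain gives an increasing sequence in the interval, and every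
  increasing sequence in it that starts at 0 arises in this way; the two sums over \<open>I\<close>
  then agree term by term.\<close>

lemma ac4_comp_iff:
  assumes P: "P \<in> NA_plus M"
  shows "ac4 M (f \<circ> measure P) P \<longleftrightarrow> absolutely_continuous_fun 0 (measure P (space M)) f"
proof
  let ?p = "measure P (space M)"
  show "absolutely_continuous_fun 0 ?p f" if ac: "ac4 M (f \<circ> measure P) P"
  proof (rule absolutely_continuous_funI_chain)
    fix e :: real assume "e > 0"
    then obtain d where "d > 0" and d: "\<forall>S m I. is_chain M S m \<longrightarrow> I \<subseteq> {..<m} \<longrightarrow>
        (\<Sum>i\<in>I. \<bar>measure P (S (Suc i)) - measure P (S i)\<bar>) < d \<longrightarrow>
        (\<Sum>i\<in>I. \<bar>f (measure P (S (Suc i))) - f (measure P (S i))\<bar>) < e"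
      using ac unfolding ac4_iff_indices comp_def by blast
    have "(\<Sum>i\<in>I. \<bar>f (x (Suc i)) - f (x i)\<bar>) < e"
      if x: "x 0 = 0" "x m \<le> ?p" "\<forall>i<m. x i \<le> x (Suc i)" and I: "I \<subseteq> {..<m}"
        and lt: "(\<Sum>i\<in>I. x (Suc i) - x i) < d" for x m I
    proof -
      obtain S where S: "is_chain M S (Suc m)" "\<And>i. i \<le> m \<Longrightarrow> measure P (S i) = x i"
        using NA_plus_chain[OF P x] by blast
      have SI: "measure P (S i) = x i \<and> measure P (S (Suc i)) = x (Suc i) \<and> x i \<le> x (Suc i)" if "i \<in> I" for i
        using S(2) x I that by (auto simp: Suc_leI)
      show ?thesis
        using d[rule_format, OF S(1), of I] SI I lt by (simp add: lessThan_Suc subset_insertI2)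
    qed
    with \<open>d > 0\<close> show "\<exists>d>0. \<forall>x m I. x 0 = 0 \<longrightarrow> x m \<le> ?p \<longrightarrow> (\<forall>i<m. x i \<le> x (Suc i)) \<longrightarrow>
        I \<subseteq> {..<m} \<longrightarrow> (\<Sum>i\<in>I. x (Suc i) - x i) < d \<longrightarrow> (\<Sum>i\<in>I. \<bar>f (x (Suc i)) - f (x i)\<bar>) < e"
      by blast
  qed simp
  show "ac4 M (f \<circ> measure P) P" if f: "absolutely_continuous_fun 0 ?p f"
    unfolding ac4_iff_indices
  proof (intro allI impI)
    fix e :: real assume "e > 0"
    obtain d where "d > 0" and d: "\<And>x m I. \<lbrakk>0 \<le> x 0; x m \<le> ?p; \<forall>i<m. x i \<le> x (Suc i); I \<subseteq> {..<m};
        (\<Sum>i\<in>I. x (Suc i) - x i) < d\<rbrakk> \<Longrightarrow> (\<Sum>i\<in>I. \<bar>f (x (Suc i)) - f (x i)\<bar>) < e"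
      using absolutely_continuous_fun_chainD[OF f \<open>e > 0\<close>] by blast
    have "(\<Sum>i\<in>I. \<bar>f (measure P (S (Suc i))) - f (measure P (S i))\<bar>) < e"
      if S: "is_chain M S m" and I: "I \<subseteq> {..<m}"
        and lt: "(\<Sum>i\<in>I. \<bar>measure P (S (Suc i)) - measure P (S i)\<bar>) < d" for S m I
    proof (rule d[of "\<lambda>i. measure P (S i)" m])
      have "(\<Sum>i\<in>I. \<bar>measure P (S (Suc i)) - measure P (S i)\<bar>) =
          (\<Sum>i\<in>I. measure P (S (Suc i)) - measure P (S i))"
        using NA_plus_chain_mono(3)[OF P S] I by (intro sum.cong) auto
      with lt show "(\<Sum>i\<in>I. measure P (S (Suc i)) - measure P (S i)) < d" by simp
    qed (use NA_plus_chain_mono[OF P S] I in auto)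
    with \<open>d > 0\<close> show "\<exists>\<delta>>0. \<forall>S m I. is_chain M S m \<longrightarrow> I \<subseteq> {..<m} \<longrightarrow>
        (\<Sum>i\<in>I. \<bar>measure P (S (Suc i)) - measure P (S i)\<bar>) < \<delta> \<longrightarrow>
        (\<Sum>i\<in>I. \<bar>(f \<circ> measure P) (S (Suc i)) - (f \<circ> measure P) (S i)\<bar>) < e"
      by auto
  qed
qed

lemma mono_on_comp_iff:
  assumes P: "P \<in> NA_plus M"
  shows "mono_on (sets M) (f \<circ> measure P) \<longleftrightarrow> mono_on {0..measure P (space M)} f"
proof
  interpret finite_measure P using NA_plusD[OF P] by simp
  let ?p = "measure P (space M)"
  show "mono_on {0..?p} f" if mono: "mono_on (sets M) (f \<circ> measure P)"
  proof (rule mono_onI)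
    fix x y assume "x \<in> {0..?p}" "y \<in> {0..?p}" "x \<le> y"
    then obtain A B where "A \<in> sets M" "B \<in> sets M" "A \<subseteq> B" "measure P A = x" "measure P B = y"
      using NA_plus_nested_range[OF P, of x y] by auto
    then show "f x \<le> f y" using mono_onD[OF mono, of A B] by auto
  qed
  show "mono_on (sets M) (f \<circ> measure P)" if mono: "mono_on {0..?p} f"
  proof (rule mono_onI)
    fix A B assume "A \<in> sets M" "B \<in> sets M" "A \<subseteq> B"
    moreover from this have "measure P A \<le> measure P B"
      using NA_plusD[OF P] by (intro finite_measure_mono) auto
    ultimately show "(f \<circ> measure P) A \<le> (f \<circ> measure P) B"
      using NA_plus_range[OF P] by (auto intro!: mono_onD[OF mono])
  qed
qed

text \<open>Chains and partitions of the interval correspond to each other under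
  \<open>measure P\<close>, so the two suprema bound one another.\<close>

lemma variation_norm_comp:
  assumes P: "P \<in> NA_plus M"
  shows "variation_norm M (f \<circ> measure P) = total_variation 0 (measure P (space M)) f"
proof (rule antisym)
  let ?p = "measure P (space M)"
  have norm_links: "subchain_norm (f \<circ> measure P) (links S m) =
      (\<Sum>i<m. \<bar>f (measure P (S (Suc i))) - f (measure P (S i))\<bar>)" if "is_chain M S m" for S m
    unfolding links_eq_image using subchain_norm_links[OF that, of "{..<m}"] by simp
  show "variation_norm M (f \<circ> measure P) \<le> total_variation 0 ?p f"
    unfolding variation_norm_def
  proof (rule SUP_least, clarify)
    fix S m assume S: "is_chain M S m"
    show "ennreal (subchain_norm (f \<circ> measure P) (links S m)) \<le> total_variation 0 ?p f"
      unfolding total_variation_def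
      by (rule SUP_upper2[of "(\<lambda>i. measure P (S i), m)"])
        (use NA_plus_chain_mono[OF P S] norm_links[OF S] in auto)
  qed
  show "total_variation 0 ?p f \<le> variation_norm M (f \<circ> measure P)"
    unfolding total_variation_def
  proof (rule SUP_least, clarify)
    fix x :: "nat \<Rightarrow> real" and m assume x: "x 0 = 0" "x m = ?p" "\<forall>i<m. x i \<le> x (Suc i)"
    then obtain S where S: "is_chain M S (Suc m)" "\<And>i. i \<le> m \<Longrightarrow> measure P (S i) = x i"
      using NA_plus_chain[OF P, of x m] by auto
    \<comment> \<open>The chain has one link more than the partition; its summand is
      nonnegative.\<close>
    have "(\<Sum>i<m. \<bar>f (x (Suc i)) - f (x i)\<bar>) \<le> subchain_norm (f \<circ> measure P) (links S (Suc m))"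
      unfolding norm_links[OF S(1)] using S(2) by (simp add: Suc_leI)
    then show "ennreal (\<Sum>i<m. \<bar>f (x (Suc i)) - f (x i)\<bar>) \<le> variation_norm M (f \<circ> measure P)"
      unfolding variation_norm_def using S(1)
      by (intro SUP_upper2[of "(S, Suc m)"]) (auto intro: ennreal_leI)
  qed
qed

theorem proposition2p1:
  fixes M P :: "'a measure" and f :: "real \<Rightarrow> real" and \<nu> :: "'a set \<Rightarrow> real" and p :: real
  assumes "standard_borel_space M"
    and "P \<in> NA_plus M"
    and "p = measure P (space M)"
    and "f 0 = 0"
    and "\<nu> = f \<circ> measure P"
  shows "ac1 M \<nu> P \<and>
    ((ac2 M \<nu> P \<longleftrightarrow> continuous (at 0 within {0..p}) f) \<and>
     (continuous (at 0 within {0..p}) f \<longleftrightarrow> (\<exists>\<mu>\<in>NA_plus M. ac2 M \<nu> \<mu>))) \<and>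
    ((ac3 M \<nu> P \<longleftrightarrow> continuous_on {0..p} f) \<and>
     (continuous_on {0..p} f \<longleftrightarrow> (\<exists>\<mu>\<in>NA_plus M. ac3 M \<nu> \<mu>))) \<and>
    ((ac4 M \<nu> P \<longleftrightarrow> absolutely_continuous_fun 0 p f) \<and>
     (absolutely_continuous_fun 0 p f \<longleftrightarrow> (\<exists>\<mu>\<in>NA_plus M. ac4 M \<nu> \<mu>))) \<and>
    (mono_on (sets M) \<nu> \<longleftrightarrow> mono_on {0..p} f) \<and>
    (\<nu> \<in> BV M \<longleftrightarrow> bounded_variation_fun 0 p f)"
proof -
  note P = \<open>P \<in> NA_plus M\<close>
  have "game (f \<circ> measure P)" using \<open>f 0 = 0\<close> by (simp add: game_def)
  then have "f \<circ> measure P \<in> BV M \<longleftrightarrow> bounded_variation_fun 0 (measure P (space M)) f"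
    by (simp add: BV_def bounded_variation_fun_def variation_norm_comp[OF P])
  \<comment> \<open>One direction is the transfer to \<open>P\<close>; for the other,
    \<open>P\<close> itself is the witness.\<close>
  moreover have "(\<exists>\<mu>\<in>NA_plus M. ac2 M (f \<circ> measure P) \<mu>) \<longleftrightarrow> ac2 M (f \<circ> measure P) P"
    "(\<exists>\<mu>\<in>NA_plus M. ac3 M (f \<circ> measure P) \<mu>) \<longleftrightarrow> ac3 M (f \<circ> measure P) P"
    "(\<exists>\<mu>\<in>NA_plus M. ac4 M (f \<circ> measure P) \<mu>) \<longleftrightarrow> ac4 M (f \<circ> measure P) P"
    using ac2_transfer[OF P] ac3_transfer[OF P] ac4_transfer[OF P] P by blast+
  ultimately show ?thesis
    unfolding assms(3,5)
    by (simp add: ac1_comp ac2_comp_iff[of P M f, OF P \<open>f 0 = 0\<close>] ac3_comp_iff[OF P]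
        ac4_comp_iff[OF P] mono_on_comp_iff[OF P])
qed

end
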